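(* For a latin square $L$ of order $n$, $$\zeta(G(L)) \leq n+O\left(\frac{\log n}{\log\log n}\right),$$ that is, there exist constants $C>0$ and $n_0$ such that for every $n\geq n_0$ and every latin square $L$ of order $n$, $\zeta(G(L)) \leq n + C\,\frac{\log n}{\log\log n}$.
   Context: A latin square $L$ of order $n$ is an $n\times n$ array with entries from a set of $n$ symbols such that each symbol occurs exactly once in each row and in each column. The latin square graph $G(L)$ is the graph whose $n^2$ vertices are the cells of $L$, where two distinct cells are adjacent if they share a row, share a column, or contain the same symbol. Localization game on a graph $G$ with $m$ cops: the robber moves first, choosing a vertex, and is invisible to the cops throughout. In each round, after the robber's move, the cops choose vertices $u_1,\dots,u_m$ (on each turn each cop may move to any vertex of the graph) and learn the distance vector $(d_1,\dots,d_m)$, where $d_i$ is the graph distance from $u_i$ to the robber's current vertex. Then, in the next round, the robber moves to an adjacent vertex or stays put, and the cops choose vertices and probe again, and so on. The cops win if they have a strategy that determines, after finitely many rounds and using all the information obtained so far, the vertex the robber occupies; the robber is omniscient, i.e. knows the entire strategy of the cops. The localization number $\zeta(G)$ is the least positive integer $m$ for which $m$ cops have a winning strategy. *)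

theory Defs
  imports Complex_Main "Graph_Theory.Pair_Digraph" "Graph_Theory.Shortest_Path"
begin

section \<open>Latin squares and latin square graphs\<close>

text \<open>
  A latin square of order \<open>n\<close> on the symbol set \<open>S\<close>, with rows and columns indexed by
  \<open>0, ..., n - 1\<close>. The values of \<open>L\<close> outside this index range are irrelevant.
\<close>

definition latin_square :: "nat \<Rightarrow> 'b set \<Rightarrow> (nat \<Rightarrow> nat \<Rightarrow> 'b) \<Rightarrow> bool" where
  "latin_square n S L \<longleftrightarrow>
     finite S \<and> card S = n \<and>
     (\<forall>i<n. \<forall>j<n. L i j \<in> S) \<and>
     (\<forall>i<n. \<forall>s\<in>S. \<exists>!j. j < n \<and> L i j = s) \<and>
     (\<forall>j<n. \<forall>s\<in>S. \<exists>!i. i < n \<and> L i j = s)"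

text \<open>
  An undirected edge is represented by the two arcs joining its end vertices.
\<close>

definition latin_square_graph :: "nat \<Rightarrow> (nat \<Rightarrow> nat \<Rightarrow> 'b) \<Rightarrow> (nat \<times> nat) pair_pre_digraph" where
  "latin_square_graph n L =
     \<lparr> pverts = {..<n} \<times> {..<n},
       parcs = {((i, j), (i', j')) | i j i' j'.
                  i < n \<and> j < n \<and> i' < n \<and> j' < n \<and> (i, j) \<noteq> (i', j') \<and>
                  (i = i' \<or> j = j' \<or> L i j = L i' j')} \<rparr>"

lemma pair_graph_latin_square_graph: "pair_graph (latin_square_graph n L)"
proof -
  let ?G = "latin_square_graph n L"
  have sub: "parcs ?G \<subseteq> pverts ?G \<times> pverts ?G"
    by (auto simp: latin_square_graph_def)
  have fin: "finite (pverts ?G)"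
    by (simp add: latin_square_graph_def)
  have "sym (parcs ?G)"
    unfolding latin_square_graph_def sym_def by auto
  then have "symmetric ?G"
    by (simp add: symmetric_def)
  moreover have "finite (parcs ?G)"
    using finite_subset[OF sub] fin by simp
  moreover have "fst e \<noteq> snd e" if "e \<in> parcs ?G" for e
    using that by (auto simp: latin_square_graph_def)
  ultimately show ?thesis
    using sub fin by unfold_locales auto
qed


section \<open>The localization game\<close>

text \<open>Graph distance; the value is \<open>\<infinity>\<close> if there is no walk from \<open>u\<close> to \<open>v\<close>.\<close>

definition graph_dist :: "'a pair_pre_digraph \<Rightarrow> 'a \<Rightarrow> 'a \<Rightarrow> ereal" where
  "graph_dist G u v = wf_digraph.\<mu> (with_proj G) (\<lambda>_. 1) u v"

text \<open>
  \<open>r t\<close> is the position of the robber at the time of the probe number \<open>t\<close>, counted from \<open>0\<close>.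
\<close>

definition robber_walk :: "'a pair_pre_digraph \<Rightarrow> (nat \<Rightarrow> 'a) \<Rightarrow> bool" where
  "robber_walk G r \<longleftrightarrow>
     (\<forall>t. r t \<in> pverts G) \<and> (\<forall>t. r (Suc t) = r t \<or> (r t, r (Suc t)) \<in> parcs G)"

text \<open>
  A strategy maps the list of all distance vectors learned so far, in chronological order, to
  the vertices to be probed next. As the strategy is deterministic, the earlier probes are
  determined by these vectors, so this is all the information the cops have.
\<close>

type_synonym 'a cop_strategy = "ereal list list \<Rightarrow> 'a list"

definition cop_strategy :: "'a pair_pre_digraph \<Rightarrow> nat \<Rightarrow> 'a cop_strategy \<Rightarrow> bool" where
  "cop_strategy G m \<sigma> \<longleftrightarrow> (\<forall>h. length (\<sigma> h) = m \<and> set (\<sigma> h) \<subseteq> pverts G)"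

text \<open>The distance vectors returned by the first \<open>t\<close> probes.\<close>

primrec answers :: "'a pair_pre_digraph \<Rightarrow> 'a cop_strategy \<Rightarrow> (nat \<Rightarrow> 'a) \<Rightarrow> nat \<Rightarrow> ereal list list" where
  "answers G \<sigma> r 0 = []"
| "answers G \<sigma> r (Suc t) =
     answers G \<sigma> r t @ [map (\<lambda>u. graph_dist G u (r t)) (\<sigma> (answers G \<sigma> r t))]"

text \<open>
  The robber is located after probe \<open>t\<close> if every robber walk consistent with all answers
  obtained up to and including that probe is at the same vertex at that time.
\<close>

definition located :: "'a pair_pre_digraph \<Rightarrow> 'a cop_strategy \<Rightarrow> (nat \<Rightarrow> 'a) \<Rightarrow> nat \<Rightarrow> bool" where
  "located G \<sigma> r t \<longleftrightarrow>
     (\<forall>r'. robber_walk G r' \<longrightarrow> answers G \<sigma> r' (Suc t) = answers G \<sigma> r (Suc t) \<longrightarrow> r' t = r t)"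

text \<open>
  The robber knows the strategy, hence can foresee all probes; thus a robber choosing the moves
  one at a time is no stronger than one committing to a whole walk in advance.
\<close>

definition cops_win :: "'a pair_pre_digraph \<Rightarrow> nat \<Rightarrow> bool" where
  "cops_win G m \<longleftrightarrow>
     (\<exists>\<sigma>. cop_strategy G m \<sigma> \<and> (\<forall>r. robber_walk G r \<longrightarrow> (\<exists>t. located G \<sigma> r t)))"

text \<open>
  The minimum exists for every finite graph with at least one vertex, since probing all vertices
  locates the robber immediately.
\<close>

definition localization_number :: "'a pair_pre_digraph \<Rightarrow> nat" where
  "localization_number G = (LEAST m. 0 < m \<and> cops_win G m)"

end

theory Submission
  imports Defs
begin

text \<open>
  In fact \<open>n + 12\<close> cops win in three rounds. Probing a whole row \<open>r\<close> reveals, for a robber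
  outside this row, the unordered pair formed by his column and the column in which his symbol
  occurs in row \<open>r\<close>. Hence at most two cells \<open>v\<close>, \<open>v'\<close> remain, and they differ in column and
  symbol. In the next round the robber is in the closed neighbourhood of \<open>v\<close> or \<open>v'\<close>; the cops
  probe the row of \<open>v\<close> and spend three more cops on each of the columns and symbols of \<open>v\<close> and
  \<open>v'\<close>, which tells whether the robber is on that line. Two candidates that are still confused
  share no column, no symbol and are outside the row of \<open>v\<close>, so both lie in the row of \<open>v'\<close>,
  and this row is not that of \<open>v\<close>. Repeating the step with two candidates in a common row
  therefore leaves no confusion.
\<close>

section \<open>Graph distance and the game\<close>

text \<open>The distance is an infimum over walks. A strict upper bound on an infimum is equivalent
  to one on some member, so comparing with thresholds avoids showing that a shortest walk
  exists.\<close>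

lemma (in wf_digraph) mu_unit_less_iff:
  "\<mu> (\<lambda>_. 1) u v < ereal c \<longleftrightarrow> (\<exists>p. awalk u p v \<and> real (length p) < c)"
proof -
  have "awalk_cost (\<lambda>_. 1) p = real (length p)" for p :: "'b list"
    by (induction p) auto
  then show ?thesis
    by (auto simp: \<mu>_def INF_less_iff)
qed

lemma graph_dist_less_one_iff:
  assumes "pair_wf_digraph G" "u \<in> pverts G"
  shows "graph_dist G u v < ereal 1 \<longleftrightarrow> u = v"
proof -
  interpret pair_wf_digraph G by fact
  have "graph_dist G u v < ereal 1 \<longleftrightarrow> awalk u [] v"
    unfolding graph_dist_def mu_unit_less_iff by auto
  then show ?thesis
    using assms by (simp add: awalk_Nil_iff)
qed

lemma graph_dist_less_two_iff:
  assumes "pair_wf_digraph G" "u \<in> pverts G"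
  shows "graph_dist G u v < ereal 2 \<longleftrightarrow> u = v \<or> (u, v) \<in> parcs G"
proof -
  interpret pair_wf_digraph G by fact
  have "graph_dist G u v < ereal 2 \<longleftrightarrow> awalk u [] v \<or> (\<exists>e. awalk u [e] v)"
  proof -
    have "real (length p) < 2 \<longleftrightarrow> p = [] \<or> (\<exists>e. p = [e])" for p :: "('a \<times> 'a) list"
      by (cases p; cases "tl p") auto
    then show ?thesis
      unfolding graph_dist_def mu_unit_less_iff by auto
  qed
  moreover have "(\<exists>e. awalk u [e] v) \<longleftrightarrow> (u, v) \<in> parcs G"
    by (auto simp: awalk_Cons_iff awalk_Nil_iff dest: in_arcsD1 in_arcsD2)
  ultimately show ?thesis
    using assms by (simp add: awalk_Nil_iff)
qed

section \<open>Position sets of the robber and strategies\<close>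

definition closed_nbhd :: "'a pair_pre_digraph \<Rightarrow> 'a set \<Rightarrow> 'a set" where
  "closed_nbhd G A = {y. \<exists>x\<in>A. y = x \<or> (x, y) \<in> parcs G}"

text \<open>\<open>B\<close> is the set of possible positions of the robber just before the next of \<open>k\<close> probes.\<close>

primrec locatable :: "'a pair_pre_digraph \<Rightarrow> nat \<Rightarrow> nat \<Rightarrow> 'a set \<Rightarrow> bool" where
  "locatable G m 0 B \<longleftrightarrow> False"
| "locatable G m (Suc k) B \<longleftrightarrow>
     (\<exists>U. length U = m \<and> set U \<subseteq> pverts G \<and>
       (\<forall>d. let A = {w \<in> B. map (\<lambda>u. graph_dist G u w) U = d} in
          (\<forall>x\<in>A. \<forall>y\<in>A. x = y) \<or> locatable G m k (closed_nbhd G A)))"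

text \<open>The conclusion is \<open>located\<close> relativised to walks starting in
  \<open>B\<close>, because the induction passes from \<open>B\<close> to the closed neighbourhood
  of an answer class. Each first answer \<open>d\<close> gets its own strategy for the remaining
  rounds.\<close>

lemma locatable_imp_strategy:
  assumes "locatable G m k B"
  shows "\<exists>\<sigma>. cop_strategy G m \<sigma> \<and> (\<forall>r. robber_walk G r \<longrightarrow> r 0 \<in> B \<longrightarrow>
           (\<exists>t. \<forall>r'. robber_walk G r' \<longrightarrow> r' 0 \<in> B \<longrightarrow>
              answers G \<sigma> r' (Suc t) = answers G \<sigma> r (Suc t) \<longrightarrow> r' t = r t))"
  using assms
proof (induction k arbitrary: B)
  case (Suc k)
  define wins where "wins \<sigma> B \<longleftrightarrow> (\<forall>r. robber_walk G r \<longrightarrow> r 0 \<in> B \<longrightarrow>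
           (\<exists>t. \<forall>r'. robber_walk G r' \<longrightarrow> r' 0 \<in> B \<longrightarrow>
              answers G \<sigma> r' (Suc t) = answers G \<sigma> r (Suc t) \<longrightarrow> r' t = r t))" for \<sigma> B
  obtain U where U: "length U = m" "set U \<subseteq> pverts G"
    and split: "\<And>d. let A = {w \<in> B. map (\<lambda>u. graph_dist G u w) U = d} in
          (\<forall>x\<in>A. \<forall>y\<in>A. x = y) \<or> locatable G m k (closed_nbhd G A)"
    using Suc.prems by auto
  define ans where "ans w = map (\<lambda>u. graph_dist G u w) U" for w
  define A where "A d = {w \<in> B. ans w = d}" for d
  have "\<exists>\<sigma>. cop_strategy G m \<sigma> \<and>
      ((\<forall>x\<in>A d. \<forall>y\<in>A d. x = y) \<or> wins \<sigma> (closed_nbhd G (A d)))" for d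
  proof (cases "\<forall>x\<in>A d. \<forall>y\<in>A d. x = y")
    case True
    \<comment> \<open>The first probe has already located the robber, so any legal strategy serves
      from here on.\<close>
    moreover have "cop_strategy G m (\<lambda>_. U)"
      using U by (simp add: cop_strategy_def)
    ultimately show ?thesis by blast
  next
    case False
    then have "locatable G m k (closed_nbhd G (A d))"
      using split[of d] by (auto simp: Let_def A_def ans_def)
    from Suc.IH[OF this] show ?thesis
      unfolding wins_def by blast
  qed
  then obtain \<tau> where \<tau>: "\<And>d. cop_strategy G m (\<tau> d)"
    "\<And>d. (\<forall>x\<in>A d. \<forall>y\<in>A d. x = y) \<or> wins (\<tau> d) (closed_nbhd G (A d))"
    by metis
  \<comment> \<open>The head of the history is the answer to \<open>U\<close> and selects the
    strategy to follow. Its tail is the history of that game, played against the walk shifted by one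
    round.\<close>
  define \<sigma> where "\<sigma> h = (case h of [] \<Rightarrow> U | d # h' \<Rightarrow> \<tau> d h')" for h
  have strat: "cop_strategy G m \<sigma>"
    using U \<tau>(1) by (auto simp: cop_strategy_def \<sigma>_def split: list.splits)
  have answers_Suc: "answers G \<sigma> r (Suc t) =
      ans (r 0) # answers G (\<tau> (ans (r 0))) (\<lambda>t. r (Suc t)) t" for r t
  proof (induction t)
    case 0
    show ?case by (simp add: \<sigma>_def ans_def)
  next
    case (Suc t)
    show ?case
      by (subst answers.simps(2), subst (1 2) Suc.IH) (simp add: \<sigma>_def)
  qed
  have "wins \<sigma> B"
    unfolding wins_def
  proof (intro allI impI)
    fix r assume r: "robber_walk G r" "r 0 \<in> B"
    let ?d = "ans (r 0)"
    show "\<exists>t. \<forall>r'. robber_walk G r' \<longrightarrow> r' 0 \<in> B \<longrightarrow>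
              answers G \<sigma> r' (Suc t) = answers G \<sigma> r (Suc t) \<longrightarrow> r' t = r t"
    proof (cases "\<forall>x\<in>A ?d. \<forall>y\<in>A ?d. x = y")
      case True
      have "r' 0 = r 0" if "r' 0 \<in> B" "answers G \<sigma> r' (Suc 0) = answers G \<sigma> r (Suc 0)" for r'
      proof -
        have "ans (r' 0) = ?d"
          using that(2) unfolding answers_Suc by simp
        then show ?thesis
          using True that(1) r(2) by (auto simp: A_def)
      qed
      then show ?thesis by blast
    next
      case False
      then have win: "wins (\<tau> ?d) (closed_nbhd G (A ?d))"
        using \<tau>(2) by blast
      have tail: "robber_walk G (\<lambda>t. q (Suc t)) \<and> q (Suc 0) \<in> closed_nbhd G (A ?d)"
        if "robber_walk G q" "q 0 \<in> A ?d" for q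
        using that by (auto simp: robber_walk_def closed_nbhd_def)
      have "r 0 \<in> A ?d"
        using r(2) by (simp add: A_def)
      with win tail[OF r(1)] obtain t where t: "\<And>q. robber_walk G q \<Longrightarrow>
          q 0 \<in> closed_nbhd G (A ?d) \<Longrightarrow>
          answers G (\<tau> ?d) q (Suc t) = answers G (\<tau> ?d) (\<lambda>t. r (Suc t)) (Suc t) \<Longrightarrow>
          q t = r (Suc t)"
        unfolding wins_def by blast
      have "r' (Suc t) = r (Suc t)" if r': "robber_walk G r'" "r' 0 \<in> B"
        "answers G \<sigma> r' (Suc (Suc t)) = answers G \<sigma> r (Suc (Suc t))" for r'
      proof -
        have eq: "ans (r' 0) = ?d"
          and rest: "answers G (\<tau> (ans (r' 0))) (\<lambda>t. r' (Suc t)) (Suc t) =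
            answers G (\<tau> ?d) (\<lambda>t. r (Suc t)) (Suc t)"
          using r'(3) unfolding answers_Suc list.inject by blast+
        have "r' 0 \<in> A ?d"
          using r'(2) eq by (simp add: A_def)
        then show ?thesis
          using t[of "\<lambda>t. r' (Suc t)"] tail[OF r'(1)] rest[unfolded eq] by blast
      qed
      then show ?thesis by blast
    qed
  qed
  with strat show ?case
    unfolding wins_def by blast
qed simp

lemma locatable_imp_cops_win:
  assumes "locatable G m k (pverts G)"
  shows "cops_win G m"
proof -
  have start: "r 0 \<in> pverts G" if "robber_walk G r" for r
    using that by (simp add: robber_walk_def)
  obtain \<sigma> where \<sigma>: "cop_strategy G m \<sigma>"
    and win: "\<And>r. robber_walk G r \<Longrightarrow> r 0 \<in> pverts G \<Longrightarrow>
      \<exists>t. \<forall>r'. robber_walk G r' \<longrightarrow> r' 0 \<in> pverts G \<longrightarrow>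
        answers G \<sigma> r' (Suc t) = answers G \<sigma> r (Suc t) \<longrightarrow> r' t = r t"
    using locatable_imp_strategy[OF assms] by auto
  have "\<exists>t. located G \<sigma> r t" if "robber_walk G r" for r
    using win[OF that start[OF that]] start unfolding located_def by metis
  with \<sigma> show ?thesis
    unfolding cops_win_def by auto
qed


section \<open>Probing a latin square graph\<close>

locale latin =
  fixes n :: nat and S :: "'b set" and L :: "nat \<Rightarrow> nat \<Rightarrow> 'b"
  assumes latin_square: "latin_square n S L"
begin

abbreviation cells :: "(nat \<times> nat) set" where
  "cells \<equiv> {..<n} \<times> {..<n}"

abbreviation sym :: "nat \<times> nat \<Rightarrow> 'b" where
  "sym w \<equiv> L (fst w) (snd w)"

text \<open>Reflexive, hence the closed adjacency relation on cells.\<close>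

definition near :: "nat \<times> nat \<Rightarrow> nat \<times> nat \<Rightarrow> bool" where
  "near u w \<longleftrightarrow> fst u = fst w \<or> snd u = snd w \<or> sym u = sym w"

text \<open>Distances in latin square graphs are at most \<open>2\<close>, so this is all that probing \<open>U\<close> reveals.\<close>

definition confused :: "(nat \<times> nat) set \<Rightarrow> nat \<times> nat \<Rightarrow> nat \<times> nat \<Rightarrow> bool" where
  "confused U w w' \<longleftrightarrow> (\<forall>u\<in>U. (u = w \<longleftrightarrow> u = w') \<and> (near u w \<longleftrightarrow> near u w'))"

lemma confused_sym: "confused U w w' \<Longrightarrow> confused U w' w"
  by (auto simp: confused_def)

lemma confused_mono: "confused U w w' \<Longrightarrow> U' \<subseteq> U \<Longrightarrow> confused U' w w'"
  by (auto simp: confused_def)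

lemma parcs_iff_near:
  assumes "u \<in> cells" "w \<in> cells"
  shows "u = w \<or> (u, w) \<in> parcs (latin_square_graph n L) \<longleftrightarrow> near u w"
  using assms by (cases u; cases w) (auto simp: latin_square_graph_def near_def)

lemma parcs_subset: "parcs (latin_square_graph n L) \<subseteq> cells \<times> cells"
  by (auto simp: latin_square_graph_def)

lemma pverts_eq [simp]: "pverts (latin_square_graph n L) = cells"
  by (simp add: latin_square_graph_def)

lemma confusedI:
  assumes U: "set U \<subseteq> cells" and w: "w \<in> cells" "w' \<in> cells"
    and eq: "map (\<lambda>u. graph_dist (latin_square_graph n L) u w) U =
      map (\<lambda>u. graph_dist (latin_square_graph n L) u w') U"
  shows "confused (set U) w w'"
  unfolding confused_def
proof
  let ?G = "latin_square_graph n L"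
  interpret pair_graph ?G by (rule pair_graph_latin_square_graph)
  have wf: "pair_wf_digraph ?G" by unfold_locales
  fix u assume u: "u \<in> set U"
  then have dist: "graph_dist ?G u w = graph_dist ?G u w'"
    using eq by simp
  have uc: "u \<in> cells" and uV: "u \<in> pverts ?G" using u U by auto
  show "(u = w \<longleftrightarrow> u = w') \<and> (near u w \<longleftrightarrow> near u w')"
    \<comment> \<open>Equal distances lie on the same side of the thresholds 1 and 2, which decide
      equality and nearness respectively.\<close>
    using graph_dist_less_one_iff[OF wf uV] graph_dist_less_two_iff[OF wf uV] dist
      parcs_iff_near[OF uc w(1)] parcs_iff_near[OF uc w(2)] by metis
qed

section \<open>What a row probe and a line test reveal\<close>

lemma sym_in: "w \<in> cells \<Longrightarrow> sym w \<in> S"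
  using latin_square by (auto simp: latin_square_def)

lemma row_inj: "i < n \<Longrightarrow> j < n \<Longrightarrow> j' < n \<Longrightarrow> L i j = L i j' \<Longrightarrow> j = j'"
  using latin_square unfolding latin_square_def by metis

lemma col_inj: "i < n \<Longrightarrow> i' < n \<Longrightarrow> j < n \<Longrightarrow> L i j = L i' j \<Longrightarrow> i = i'"
  using latin_square unfolding latin_square_def by metis

lemma row_surj: "i < n \<Longrightarrow> s \<in> S \<Longrightarrow> \<exists>j<n. L i j = s"
  using latin_square unfolding latin_square_def by metis

text \<open>Off row \<open>r\<close>, the answer is the unordered pair of a cell's own column and
  the column of its symbol in row \<open>r\<close>. Two distinct cells with the same pair cannot
  agree in their own columns, as column and symbol determine a cell; so the two entries are
  interchanged.\<close>

lemma confused_row: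
  assumes r: "r < n" and w: "w \<in> cells" "w' \<in> cells" "w \<noteq> w'"
    and conf: "confused ({r} \<times> {..<n}) w w'"
  shows "fst w \<noteq> r" "snd w \<noteq> snd w'" "sym w \<noteq> sym w'" "L r (snd w) = sym w'"
proof -
  \<comment> \<open>A cell of row \<open>r\<close> is itself probed, so the equality clause of
    \<open>confused\<close> identifies it.\<close>
  have outside: "fst x \<noteq> r" if "x \<in> cells" "x \<noteq> y" "confused ({r} \<times> {..<n}) x y" for x y
    using that by (cases x) (auto simp: confused_def)
  from outside[OF w(1,3) conf] outside[OF w(2) w(3)[symmetric] confused_sym[OF conf]]
  have out: "fst w \<noteq> r" "fst w' \<noteq> r" by auto
  have bd: "fst w < n" "snd w < n" "fst w' < n" "snd w' < n"
    using w by auto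
  have near_iff: "j = snd w \<or> L r j = sym w \<longleftrightarrow> j = snd w' \<or> L r j = sym w'" if "j < n" for j
    using conf that out by (auto simp: confused_def near_def)
  show "fst w \<noteq> r" by fact
  show col: "snd w \<noteq> snd w'"
  proof
    assume c: "snd w = snd w'"
    obtain j where j: "j < n" "L r j = sym w"
      using row_surj[OF r sym_in[OF w(1)]] by blast
    then have "j \<noteq> snd w"
      using col_inj[OF r bd(1,2)] out by metis
    then have "sym w = sym w'"
      using near_iff[OF j(1)] j c by auto
    then have "fst w = fst w'"
      using col_inj[OF bd(1,3,2)] c by simp
    then show False
      using c w(3) by (simp add: prod_eq_iff)
  qed
  show *: "L r (snd w) = sym w'"
    using near_iff[OF bd(2)] col by auto
  show "sym w \<noteq> sym w'"
    using * col_inj[OF r bd(1,2)] out by metis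
qed

text \<open>By the interchange, the column and the symbol of any partner of \<open>w\<close> are
  both determined by \<open>w\<close>, and these determine the partner. Hence an answer class has at
  most two cells.\<close>

lemma confused_row_unique:
  assumes r: "r < n" and cells: "w \<in> cells" "x \<in> cells" "y \<in> cells" and ne: "w \<noteq> x" "w \<noteq> y"
    and conf: "confused ({r} \<times> {..<n}) w x" "confused ({r} \<times> {..<n}) w y"
  shows "x = y"
proof -
  have "L r (snd x) = L r (snd y)"
    using confused_row(4)[OF r cells(2,1) ne(1)[symmetric] confused_sym[OF conf(1)]]
      confused_row(4)[OF r cells(3,1) ne(2)[symmetric] confused_sym[OF conf(2)]] by simp
  then have col: "snd x = snd y"
    using row_inj[OF r] cells by auto
  have "sym x = sym y"
    using confused_row(4)[OF r cells(1,2) ne(1) conf(1)]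
      confused_row(4)[OF r cells(1,3) ne(2) conf(2)] by simp
  then have "fst x = fst y"
    using col_inj[of "fst x" "fst y" "snd x"] col cells by auto
  with col show ?thesis by (simp add: prod_eq_iff)
qed

text \<open>Three cops suffice to test a line, as a cell off the line is near at most two of its cells.\<close>

lemma column_test:
  assumes n: "n \<ge> 3" and c: "c < n"
  shows "\<exists>T. length T = 3 \<and> set T \<subseteq> cells \<and> (\<forall>w\<in>cells. (\<forall>u\<in>set T. near u w) \<longleftrightarrow> snd w = c)"
proof (intro exI conjI ballI)
  let ?T = "map (\<lambda>k. (k, c)) [0..<3]"
  show "length ?T = 3" by simp
  show "set ?T \<subseteq> cells" using n c by auto
  fix w assume w: "w \<in> cells"
  show "(\<forall>u\<in>set ?T. near u w) \<longleftrightarrow> snd w = c"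
  proof
    assume near: "\<forall>u\<in>set ?T. near u w"
    have near_k: "k = fst w \<or> c = snd w \<or> L k c = sym w" if "k < 3" for k
      using near that by (auto simp: near_def)
    have "L 0 c \<noteq> L 1 c" "L 0 c \<noteq> L 2 c" "L 1 c \<noteq> L 2 c"
      using col_inj[of 0 1 c] col_inj[of 0 2 c] col_inj[of 1 2 c] n c by auto
    then show "snd w = c"
      using near_k[of 0] near_k[of 1] near_k[of 2] by auto
  qed (auto simp: near_def)
qed

lemma symbol_test:
  assumes n: "n \<ge> 3" and s: "s \<in> S"
  shows "\<exists>T. length T = 3 \<and> set T \<subseteq> cells \<and> (\<forall>w\<in>cells. (\<forall>u\<in>set T. near u w) \<longleftrightarrow> sym w = s)"
proof -
  from row_surj[OF _ s] obtain f where f: "\<And>i. i < n \<Longrightarrow> f i < n \<and> L i (f i) = s"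
    by metis
  let ?T = "map (\<lambda>k. (k, f k)) [0..<3]"
  have "(\<forall>u\<in>set ?T. near u w) \<longleftrightarrow> sym w = s" for w
  proof
    assume near: "\<forall>u\<in>set ?T. near u w"
    have near_k: "k = fst w \<or> f k = snd w \<or> s = sym w" if "k < 3" for k
      using near that f[of k] n by (auto simp: near_def)
    \<comment> \<open>The three cells carry the same symbol in distinct rows, so their columns
      differ. A cell with another symbol meets at most one of them by row and at most one by
      column.\<close>
    have "f i \<noteq> f j" if "i < 3" "j < 3" "i \<noteq> j" for i j
      using col_inj[of i j "f i"] f[of i] f[of j] that n by auto
    then have "f 0 \<noteq> f 1" "f 0 \<noteq> f 2" "f 1 \<noteq> f 2" by auto
    then show "sym w = s"
      using near_k[of 0] near_k[of 1] near_k[of 2] by auto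
  next
    assume "sym w = s"
    then show "\<forall>u\<in>set ?T. near u w"
      using f n by (auto simp: near_def)
  qed
  moreover have "length ?T = 3" "set ?T \<subseteq> cells"
    using f n by auto
  ultimately show ?thesis by blast
qed

lemma confused_test:
  assumes "confused U w w'" "T \<subseteq> U"
  shows "(\<forall>u\<in>T. near u w) \<longleftrightarrow> (\<forall>u\<in>T. near u w')"
  using assms by (auto simp: confused_def)

text \<open>The count is \<open>n\<close> cops for the row of \<open>v\<close> plus three for each
  of four lines: the columns and the symbols of \<open>v\<close> and \<open>v'\<close>.\<close>

lemma probe_two_candidates:
  assumes n: "n \<ge> 3" and v: "v \<in> cells" "v' \<in> cells"
  obtains U where "length U = n + 12" "set U \<subseteq> cells" "{fst v} \<times> {..<n} \<subseteq> set U"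
    and "\<forall>w\<in>cells. \<forall>w'\<in>cells. w \<noteq> w' \<longrightarrow> near v w \<or> near v' w \<longrightarrow> near v w' \<or> near v' w' \<longrightarrow>
       confused (set U) w w' \<longrightarrow> fst w = fst v' \<and> fst w' = fst v' \<and> fst v \<noteq> fst v'"
proof -
  have bd: "fst v < n" "snd v < n" "snd v' < n"
    using v by auto
  obtain T1 where T1: "length T1 = 3" "set T1 \<subseteq> cells"
    "\<And>w. w \<in> cells \<Longrightarrow> (\<forall>u\<in>set T1. near u w) \<longleftrightarrow> snd w = snd v"
    using column_test[OF n bd(2)] by blast
  obtain T2 where T2: "length T2 = 3" "set T2 \<subseteq> cells"
    "\<And>w. w \<in> cells \<Longrightarrow> (\<forall>u\<in>set T2. near u w) \<longleftrightarrow> snd w = snd v'"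
    using column_test[OF n bd(3)] by blast
  obtain T3 where T3: "length T3 = 3" "set T3 \<subseteq> cells"
    "\<And>w. w \<in> cells \<Longrightarrow> (\<forall>u\<in>set T3. near u w) \<longleftrightarrow> sym w = sym v"
    using symbol_test[OF n sym_in[OF v(1)]] by blast
  obtain T4 where T4: "length T4 = 3" "set T4 \<subseteq> cells"
    "\<And>w. w \<in> cells \<Longrightarrow> (\<forall>u\<in>set T4. near u w) \<longleftrightarrow> sym w = sym v'"
    using symbol_test[OF n sym_in[OF v(2)]] by blast
  let ?R = "map (\<lambda>j. (fst v, j)) [0..<n]"
  define U where "U = ?R @ T1 @ T2 @ T3 @ T4"
  have R: "set ?R = {fst v} \<times> {..<n}" by auto
  have sub: "set ?R \<subseteq> set U" "set T1 \<subseteq> set U" "set T2 \<subseteq> set U" "set T3 \<subseteq> set U"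
    "set T4 \<subseteq> set U"
    unfolding U_def by auto
  have concl: "fst w = fst v' \<and> fst w' = fst v' \<and> fst v \<noteq> fst v'"
    if w: "w \<in> cells" "w' \<in> cells" "w \<noteq> w'" and near: "near v w \<or> near v' w" "near v w' \<or> near v' w'"
      and conf: "confused (set U) w w'" for w w'
  proof -
    have confR: "confused ({fst v} \<times> {..<n}) w w'"
      using confused_mono[OF conf sub(1)] unfolding R .
    note row = confused_row[OF bd(1) w confR]
    note row' = confused_row(1)[OF bd(1) w(2,1) w(3)[symmetric] confused_sym[OF confR]]
    note test = confused_test[OF conf sub(2)] confused_test[OF conf sub(3)]
      confused_test[OF conf sub(4)] confused_test[OF conf sub(5)]
    have lines: "snd w = snd v \<longleftrightarrow> snd w' = snd v" "snd w = snd v' \<longleftrightarrow> snd w' = snd v'"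
      "sym w = sym v \<longleftrightarrow> sym w' = sym v" "sym w = sym v' \<longleftrightarrow> sym w' = sym v'"
      using test T1(3)[OF w(1)] T1(3)[OF w(2)] T2(3)[OF w(1)] T2(3)[OF w(2)]
        T3(3)[OF w(1)] T3(3)[OF w(2)] T4(3)[OF w(1)] T4(3)[OF w(2)] by blast+
    \<comment> \<open>If \<open>w\<close> or \<open>w'\<close> were on one of the tested lines, both
      would be, but they differ in column and symbol. They are also outside the row of
      \<open>v\<close>, so the row of \<open>v'\<close> is the only remaining source of
      nearness.\<close>
    show ?thesis
      using near row(1-3) row' lines unfolding near_def by metis
  qed
  have len: "length U = n + 12"
    using T1(1) T2(1) T3(1) T4(1) by (simp add: U_def)
  have cells: "set U \<subseteq> cells"
    using T1(2) T2(2) T3(2) T4(2) bd(1) by (auto simp: U_def)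
  show thesis
    by (rule that[OF len cells sub(1)[unfolded R]], intro ballI impI) (rule concl)
qed

section \<open>The three rounds\<close>

text \<open>The covering of \<open>B\<close> by \<open>v\<close> and \<open>v'\<close> is placed
  inside \<open>next_round\<close>, guarding only the row information. Thus the opening round, where
  \<open>B\<close> consists of all cells, is an instance as well.\<close>

lemma locatable_step:
  fixes v v' :: "nat \<times> nat"
  defines "G \<equiv> latin_square_graph n L"
  assumes n: "n \<ge> 3" and v: "v \<in> cells" "v' \<in> cells"
    and B: "B \<subseteq> cells"
    and next_round: "\<And>w w'. \<lbrakk>w \<in> B; w' \<in> B; w \<noteq> w';
        (\<forall>x\<in>B. near v x \<or> near v' x) \<Longrightarrow> fst w = fst v' \<and> fst w' = fst v' \<and> fst v \<noteq> fst v'\<rbrakk>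
      \<Longrightarrow> locatable G (n + 12) k (closed_nbhd G {w, w'})"
  shows "locatable G (n + 12) (Suc k) B"
proof -
  have r: "fst v < n" using v by auto
  obtain U where U: "length U = n + 12" "set U \<subseteq> cells" and row: "{fst v} \<times> {..<n} \<subseteq> set U"
    and test: "\<forall>w\<in>cells. \<forall>w'\<in>cells. w \<noteq> w' \<longrightarrow> near v w \<or> near v' w \<longrightarrow> near v w' \<or> near v' w' \<longrightarrow>
       confused (set U) w w' \<longrightarrow> fst w = fst v' \<and> fst w' = fst v' \<and> fst v \<noteq> fst v'"
    by (rule probe_two_candidates[OF n v]) (rule that)
  define A where "A d = {w \<in> B. map (\<lambda>u. graph_dist G u w) U = d}" for d
  have conf: "confused (set U) x y" if "x \<in> A d" "y \<in> A d" for x y d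
  proof (rule confusedI[OF U(2)])
    show "x \<in> cells" "y \<in> cells"
      using that B unfolding A_def by blast+
  qed (use that in \<open>simp only: A_def G_def mem_Collect_eq\<close>)
  have "(\<forall>x\<in>A d. \<forall>y\<in>A d. x = y) \<or> locatable G (n + 12) k (closed_nbhd G (A d))" for d
  proof (cases "\<forall>x\<in>A d. \<forall>y\<in>A d. x = y")
    case False
    then obtain w w' where w: "w \<in> A d" "w' \<in> A d" "w \<noteq> w'" by blast
    have AB: "A d \<subseteq> B" by (auto simp: A_def)
    have wc: "w \<in> cells" "w' \<in> cells" and wB: "w \<in> B" "w' \<in> B" using w AB B by auto
    have "y = w'" if y: "y \<in> A d" "y \<noteq> w" for y
    proof -
      have "y \<in> cells" using y AB B by auto
      then show ?thesis
        using confused_row_unique[OF r wc(1) _ wc(2) y(2)[symmetric] w(3)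
            confused_mono[OF conf[OF w(1) y(1)] row] confused_mono[OF conf[OF w(1,2)] row]]
        by blast
    qed
    then have "A d = {w, w'}" using w by blast
    moreover have "locatable G (n + 12) k (closed_nbhd G {w, w'})"
    proof (rule next_round[OF wB w(3)])
      assume "\<forall>x\<in>B. near v x \<or> near v' x"
      then have "near v w \<or> near v' w" "near v w' \<or> near v' w'" using wB by blast+
      then show "fst w = fst v' \<and> fst w' = fst v' \<and> fst v \<noteq> fst v'"
        by (rule test[rule_format, OF wc w(3) _ _ conf[OF w(1,2)]])
    qed
    ultimately show ?thesis by simp
  qed simp
  then show ?thesis
    using U unfolding locatable.simps Let_def A_def
    by (intro exI[of _ U]) (simp add: G_def)
qed

lemma closed_nbhd_pair:
  assumes "w \<in> cells" "w' \<in> cells"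
  shows "closed_nbhd (latin_square_graph n L) {w, w'} \<subseteq> cells"
    and "x \<in> closed_nbhd (latin_square_graph n L) {w, w'} \<Longrightarrow> near w x \<or> near w' x"
proof -
  show sub: "closed_nbhd (latin_square_graph n L) {w, w'} \<subseteq> cells"
    using assms parcs_subset unfolding closed_nbhd_def by blast
  assume x: "x \<in> closed_nbhd (latin_square_graph n L) {w, w'}"
  with sub have "x \<in> cells" by blast
  then show "near w x \<or> near w' x"
    using x parcs_iff_near[OF assms(1)] parcs_iff_near[OF assms(2)]
    unfolding closed_nbhd_def by blast
qed

lemma cops_win_latin:
  assumes n: "n \<ge> 3"
  shows "cops_win (latin_square_graph n L) (n + 12)"
proof -
  let ?G = "latin_square_graph n L"
  have one: "locatable ?G (n + 12) (Suc 0) (closed_nbhd ?G {w, w'})"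
    if "w \<in> cells" "w' \<in> cells" "fst w = fst w'" for w w'
  proof (rule locatable_step[OF n that(1,2) closed_nbhd_pair(1)[OF that(1,2)]])
    fix x x' :: "nat \<times> nat"
    assume "\<forall>x\<in>closed_nbhd ?G {w, w'}. near w x \<or> near w' x \<Longrightarrow>
        fst x = fst w' \<and> fst x' = fst w' \<and> fst w \<noteq> fst w'"
    \<comment> \<open>The two candidates share a row, whereas a surviving confusion would put them
      in different rows.\<close>
    then have False
      using closed_nbhd_pair(2)[OF that(1,2)] that(3) by auto
    then show "locatable ?G (n + 12) 0 (closed_nbhd ?G {x, x'})" ..
  qed
  have two: "locatable ?G (n + 12) (Suc (Suc 0)) (closed_nbhd ?G {w, w'})"
    if "w \<in> cells" "w' \<in> cells" for w w'
  proof (rule locatable_step[OF n that closed_nbhd_pair(1)[OF that]])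
    fix x x'
    assume x: "x \<in> closed_nbhd ?G {w, w'}" "x' \<in> closed_nbhd ?G {w, w'}"
      and *: "\<forall>x\<in>closed_nbhd ?G {w, w'}. near w x \<or> near w' x \<Longrightarrow>
        fst x = fst w' \<and> fst x' = fst w' \<and> fst w \<noteq> fst w'"
    \<comment> \<open>Both survivors are in the row of \<open>w'\<close>, so they form a pair to
      which \<open>one\<close> applies.\<close>
    have "fst x = fst x'"
      using * closed_nbhd_pair(2)[OF that] by auto
    then show "locatable ?G (n + 12) (Suc 0) (closed_nbhd ?G {x, x'})"
      by (rule one[rotated 2]) (use x closed_nbhd_pair(1)[OF that] in blast)+
  qed
  \<comment> \<open>Nothing is known before the first probe, so an arbitrary cell serves as both
    candidates. Only the split into classes of at most two cells matters here.\<close>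
  have origin: "(0, 0) \<in> cells" using n by auto
  have "locatable ?G (n + 12) (Suc (Suc (Suc 0))) cells"
    by (rule locatable_step[OF n origin origin subset_refl two])
  then show ?thesis
    by (rule locatable_imp_cops_win[of ?G "n + 12", unfolded pverts_eq])
qed

end

section \<open>The asymptotic bound\<close>

lemma localization_number_latin_le:
  assumes "latin_square n S L" "n \<ge> 3"
  shows "localization_number (latin_square_graph n L) \<le> n + 12"
proof -
  interpret latin n S L by unfold_locales fact
  show ?thesis
    unfolding localization_number_def
    using cops_win_latin[OF assms(2)] by (intro Least_le) simp
qed

text \<open>Lets the additive constant 12 be absorbed into the error term. It is
  \<open>ln y \<le> y - 1\<close> at \<open>y = ln x\<close>, and \<open>x > exp 1\<close> makes the
  denominator positive.\<close>

lemma ln_div_ln_ln_ge_1: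
  assumes "x > exp (1::real)"
  shows "ln x / ln (ln x) \<ge> 1"
proof -
  have "1 < ln x"
    using assms by (smt (verit) exp_gt_zero ln_exp ln_less_cancel_iff)
  moreover from this have "ln (ln x) \<le> ln x - 1"
    by (intro ln_le_minus_one) simp
  ultimately show ?thesis by simp
qed

theorem corollary4p3:
  shows "\<exists>C::real. C > 0 \<and> (\<exists>n0::nat. \<forall>n\<ge>n0. \<forall>(S :: nat set) (L :: nat \<Rightarrow> nat \<Rightarrow> nat).
           latin_square n S L \<longrightarrow>
             real (localization_number (latin_square_graph n L))
               \<le> real n + C * (ln (real n) / ln (ln (real n))))"
proof (intro exI conjI allI impI)
  show "(12::real) > 0" by simp
  fix n :: nat and S :: "nat set" and L :: "nat \<Rightarrow> nat \<Rightarrow> nat"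
  \<comment> \<open>The threshold 4 gives \<open>n > exp 1\<close>, since \<open>exp_le\<close>
    bounds \<open>exp 1\<close> by 3.\<close>
  assume n: "4 \<le> n" and L: "latin_square n S L"
  have "localization_number (latin_square_graph n L) \<le> n + 12"
    using localization_number_latin_le[OF L] n by simp
  moreover have "ln (real n) / ln (ln (real n)) \<ge> 1"
    by (rule ln_div_ln_ln_ge_1) (use exp_le n in linarith)
  ultimately show "real (localization_number (latin_square_graph n L))
      \<le> real n + 12 * (ln (real n) / ln (ln (real n)))"
    by linarith
qed

end
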